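(* Let $K\ge 2$ be an integer, let $0<p_i<1$ ($i=1,\dots,K$) with $\sum_{i=1}^K p_i=1$, and let $0\le\delta\le 1$. Let $N\ge 1$ and let $\epsilon_1,\dots,\epsilon_N$ be a sequence of dependent categorical random variables with categories $\{1,\dots,K\}$, probabilities $p_1,\dots,p_K$ and dependency coefficient $\delta$ (as defined in the context). For $i=1,\dots,K$ let $X_i=\#\{j\in\{1,\dots,N\}:\epsilon_j=i\}$, and let $\mathbf{X}=(X_1,\dots,X_K)$. Then for every $\mathbf{x}=(x_1,\dots,x_K)$ of nonnegative integers with $\sum_{i=1}^K x_i=N$, $$P(\mathbf{X}=\mathbf{x})=\sum_{i=1}^{K}p_i\,\frac{(N-1)!}{(x_i-1)!\prod_{j\ne i}x_j!}\,\bigl(p_i^{+}\bigr)^{x_i-1}\prod_{j\ne i}\bigl(p_j^{-}\bigr)^{x_j},$$ where a summand with $x_i=0$ is interpreted as $0$.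
   Context: For $i=1,\dots,K$ put $p_i^{+}:=p_i+\delta\sum_{l\ne i}p_l$ and $p_i^{-}:=p_i-\delta p_i$. A sequence of dependent categorical random variables $\epsilon_1,\dots,\epsilon_N$ with categories $\{1,\dots,K\}$, probabilities $p_1,\dots,p_K$ and dependency coefficient $\delta$ is a sequence of $\{1,\dots,K\}$-valued random variables on a common probability space whose joint distribution is $$P(\epsilon_1=e_1,\dots,\epsilon_N=e_N)=p_{e_1}\prod_{j=2}^{N} w(e_1,e_j),\qquad w(i,k):=\begin{cases}p_i^{+}, & k=i,\\ p_k^{-}, & k\ne i,\end{cases}$$ for all $(e_1,\dots,e_N)\in\{1,\dots,K\}^N$ (empty product equal to $1$ when $N=1$). Convention: $0^0=1$. *)

theory Defs
  imports "HOL-Probability.Probability"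
begin

definition p_plus :: "nat \<Rightarrow> (nat \<Rightarrow> real) \<Rightarrow> real \<Rightarrow> nat \<Rightarrow> real" where
  "p_plus K p \<delta> i = p i + \<delta> * (\<Sum>l\<in>{1..K} - {i}. p l)"

definition p_minus :: "(nat \<Rightarrow> real) \<Rightarrow> real \<Rightarrow> nat \<Rightarrow> real" where
  "p_minus p \<delta> i = p i - \<delta> * p i"

definition dep_weight :: "nat \<Rightarrow> (nat \<Rightarrow> real) \<Rightarrow> real \<Rightarrow> nat \<Rightarrow> nat \<Rightarrow> real" where
  "dep_weight K p \<delta> i k = (if k = i then p_plus K p \<delta> i else p_minus p \<delta> k)"

(* Only the values \<epsilon> 1, ..., \<epsilon> N and p 1, ..., p K matter. Measurability into
   count_space {1..K} also says that each \<epsilon> j takes its values in {1..K} on the whole space. *)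
definition dep_categorical ::
  "'a measure \<Rightarrow> nat \<Rightarrow> (nat \<Rightarrow> real) \<Rightarrow> real \<Rightarrow> nat \<Rightarrow> (nat \<Rightarrow> 'a \<Rightarrow> nat) \<Rightarrow> bool" where
  "dep_categorical M K p \<delta> N \<epsilon> \<longleftrightarrow>
     prob_space M \<and>
     (\<forall>j\<in>{1..N}. \<epsilon> j \<in> measurable M (count_space {1..K})) \<and>
     (\<forall>e \<in> {1..N} \<rightarrow>\<^sub>E {1..K}.
        measure M {\<omega> \<in> space M. \<forall>j\<in>{1..N}. \<epsilon> j \<omega> = e j}
          = p (e 1) * (\<Prod>j=2..N. dep_weight K p \<delta> (e 1) (e j)))"

definition cat_count :: "nat \<Rightarrow> (nat \<Rightarrow> 'a \<Rightarrow> nat) \<Rightarrow> nat \<Rightarrow> 'a \<Rightarrow> nat" where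
  "cat_count N \<epsilon> i \<omega> = card {j \<in> {1..N}. \<epsilon> j \<omega> = i}"

end

theory Submission
  imports Defs
begin

text \<open>
  The joint probability of a sequence \<open>e\<close> depends only on its first entry \<open>i = e 1\<close> and on how
  often each category occurs: the first entry contributes \<open>p i\<close>, each of the \<open>x i - 1\<close> later
  occurrences of \<open>i\<close> contributes \<open>p\<^sub>i\<^sup>+\<close>, and each of the \<open>x j\<close> occurrences of another category \<open>j\<close> contributes
  \<open>p\<^sub>j\<^sup>-\<close> (\<open>prod_dep_weight\<close>). So the probability that the counts are \<open>x\<close> is
  a sum over \<open>i\<close> of this common value times the number of sequences with counts \<open>x\<close> that start
  with \<open>i\<close>.

  Deleting the first entry identifies these sequences with the words on \<open>{2..N}\<close> whose counts are
  \<open>x\<close> with the entry at \<open>i\<close> lowered by one (\<open>bij_betw_delete_position\<close>). Their number is a multinomial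
  coefficient (\<open>card_words_with_counts\<close>), which is in turn proved by deleting one position at a
  time.
\<close>

section \<open>Words with prescribed counts\<close>

definition words_with_counts :: "'i set \<Rightarrow> 'c set \<Rightarrow> ('c \<Rightarrow> nat) \<Rightarrow> ('i \<Rightarrow> 'c) set" where
  "words_with_counts A S x = {f \<in> A \<rightarrow>\<^sub>E S. \<forall>i\<in>S. card {a\<in>A. f a = i} = x i}"

lemma finite_words_with_counts:
  "finite A \<Longrightarrow> finite S \<Longrightarrow> finite (words_with_counts A S x)"
  unfolding words_with_counts_def by (rule finite_subset[of _ "A \<rightarrow>\<^sub>E S"]) (auto intro: finite_PiE)

lemma card_fibre_insert:
  assumes "finite A" "a \<notin> A"
  shows "card {b\<in>insert a A. f b = i} = card {b\<in>A. f b = i} + (if f a = i then 1 else 0)"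
proof -
  have "{b\<in>insert a A. f b = i} =
      (if f a = i then insert a {b\<in>A. f b = i} else {b\<in>A. f b = i})"
    by auto
  then show ?thesis using assms by simp
qed

text \<open>
  The words are extensional functions, so deleting a position means resetting its value to
  \<open>undefined\<close>. Once the deleted letter \<open>i\<close> is fixed, this loses no information, and only the count
  of \<open>i\<close> drops.
\<close>

lemma bij_betw_delete_position:
  assumes A: "finite A" "a \<notin> A" and i: "i \<in> S" "x i > 0"
  shows "bij_betw (\<lambda>f. f(a := undefined))
    {f \<in> words_with_counts (insert a A) S x. f a = i}
    (words_with_counts A S (x(i := x i - 1)))"
proof (rule bij_betwI[where g = "\<lambda>g. g(a := i)"])
  have same: "{b\<in>A. (f(a := c)) b = k} = {b\<in>A. f b = k}" for f :: "'a \<Rightarrow> 'b" and c k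
    using A(2) by auto
  show "(\<lambda>f. f(a := undefined)) \<in> {f \<in> words_with_counts (insert a A) S x. f a = i}
      \<rightarrow> words_with_counts A S (x(i := x i - 1))"
  proof
    fix f assume "f \<in> {f \<in> words_with_counts (insert a A) S x. f a = i}"
    then have f: "f \<in> insert a A \<rightarrow>\<^sub>E S" "f a = i"
      and c: "\<And>k. k \<in> S \<Longrightarrow> card {b\<in>insert a A. f b = k} = x k"
      by (auto simp: words_with_counts_def)
    have "card {b\<in>A. f b = k} = (x(i := x i - 1)) k" if "k \<in> S" for k
      using c[OF that] card_fibre_insert[OF A, of f k] f(2) by auto
    moreover have "f(a := undefined) \<in> A \<rightarrow>\<^sub>E S"
      using f A(2) by (auto simp: PiE_iff extensional_def)
    ultimately show "f(a := undefined) \<in> words_with_counts A S (x(i := x i - 1))"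
      unfolding words_with_counts_def mem_Collect_eq same by simp
  qed
  show "(\<lambda>g. g(a := i)) \<in> words_with_counts A S (x(i := x i - 1))
      \<rightarrow> {f \<in> words_with_counts (insert a A) S x. f a = i}"
  proof
    fix g assume "g \<in> words_with_counts A S (x(i := x i - 1))"
    then have g: "g \<in> A \<rightarrow>\<^sub>E S"
      and c: "\<And>k. k \<in> S \<Longrightarrow> card {b\<in>A. g b = k} = (x(i := x i - 1)) k"
      by (auto simp: words_with_counts_def)
    have "card {b\<in>insert a A. (g(a := i)) b = k} = x k" if "k \<in> S" for k
      unfolding card_fibre_insert[OF A] same using c[OF that] i(2) by auto
    moreover have "g(a := i) \<in> insert a A \<rightarrow>\<^sub>E S"
      using g i(1) by (auto simp: PiE_iff extensional_def)
    ultimately show "g(a := i) \<in> {f \<in> words_with_counts (insert a A) S x. f a = i}"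
      unfolding words_with_counts_def by simp
  qed
  show "(f(a := undefined))(a := i) = f"
    if "f \<in> {f \<in> words_with_counts (insert a A) S x. f a = i}" for f
    using that by auto
  show "(g(a := i))(a := undefined) = g"
    if "g \<in> words_with_counts A S (x(i := x i - 1))" for g
    using that A(2) by (auto simp: words_with_counts_def PiE_iff extensional_def fun_eq_iff)
qed

lemma words_with_counts_value_pos:
  assumes "finite A" "a \<in> A" "f \<in> words_with_counts A S x"
  shows "x (f a) > 0"
proof -
  have "f a \<in> S" "card {b\<in>A. f b = f a} = x (f a)"
    using assms by (auto simp: words_with_counts_def)
  moreover have "card {b\<in>A. f b = f a} > 0"
    using assms by (auto simp: card_gt_0_iff)
  ultimately show ?thesis by simp
qed

text \<open>
  The multinomial coefficient, in a form free of division. After multiplication by the factorials,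
  the words with value \<open>i\<close> at a chosen position contribute \<open>x i * fact n\<close>, where \<open>n\<close> is the number of
  remaining positions, and \<open>\<Sum>i\<in>S. x i = n + 1\<close>.
\<close>

lemma card_words_with_counts:
  fixes A :: "'i set" and S :: "'c set"
  assumes "finite A" "finite S" "sum x S = card A"
  shows "card (words_with_counts A S x) * (\<Prod>i\<in>S. fact (x i)) = fact (card A)"
  using assms(1,3)
proof (induction A arbitrary: x rule: finite_induct)
  case empty
  then have "x i = 0" if "i \<in> S" for i using assms(2) that by simp
  moreover from this have "words_with_counts ({} :: 'i set) S x = {\<lambda>_. undefined}"
    by (auto simp: words_with_counts_def)
  ultimately show ?case by simp
next
  case (insert a A)
  let ?W = "words_with_counts (insert a A) S x"
  have fibre: "card {f\<in>?W. f a = i} * (\<Prod>k\<in>S. fact (x k)) = x i * fact (card A)" if i: "i \<in> S" for i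
  proof (cases "x i = 0")
    case True
    then have "{f\<in>?W. f a = i} = {}"
      using words_with_counts_value_pos[of "insert a A" a _ S x] insert.hyps by force
    then show ?thesis using True by (simp only: card.empty mult_0)
  next
    case False
    let ?y = "x(i := x i - 1)"
    have "sum x S = x i + sum x (S - {i})" "sum ?y S = (x i - 1) + sum x (S - {i})"
      using assms(2) i by (simp_all add: sum.remove)
    then have "sum ?y S = card A"
      using insert.prems insert.hyps False by simp
    note IH = insert.IH[OF this]
    have "(\<Prod>k\<in>S. fact (x k)) = x i * (\<Prod>k\<in>S. fact (?y k) :: nat)"
      using assms(2) i False by (simp add: prod.remove fact_reduce[of "x i"])
    moreover have "card {f\<in>?W. f a = i} = card (words_with_counts A S ?y)"
      using insert.hyps i False
      by (intro bij_betw_same_card[OF bij_betw_delete_position]) auto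
    ultimately show ?thesis by (simp only: mult_ac flip: IH)
  qed
  have "?W = (\<Union>i\<in>S. {f\<in>?W. f a = i})"
    by (auto simp: words_with_counts_def)
  also have "card \<dots> = (\<Sum>i\<in>S. card {f\<in>?W. f a = i})"
    using insert.hyps assms(2) by (subst card_UN_disjoint) (auto simp: finite_words_with_counts)
  finally have "card ?W * (\<Prod>i\<in>S. fact (x i)) = (\<Sum>i\<in>S. x i * fact (card A))"
    by (simp add: sum_distrib_right fibre)
  also have "\<dots> = fact (card (insert a A))"
    using insert by (simp flip: sum_distrib_right)
  finally show ?case .
qed

section \<open>The distribution of the counts\<close>

text \<open>
  The weight of a position depends only on its category once the first category \<open>i\<close> is known, so
  the product over positions can be collected by category.
\<close>

lemma prod_dep_weight:
  fixes e :: "nat \<Rightarrow> nat"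
  assumes e: "e \<in> words_with_counts {2..N} {1..K} y" and i: "i \<in> {1..K}"
  shows "(\<Prod>j=2..N. dep_weight K p \<delta> i (e j)) =
    p_plus K p \<delta> i ^ y i * (\<Prod>k\<in>{1..K} - {i}. p_minus p \<delta> k ^ y k)"
proof -
  have sub: "e ` {2..N} \<subseteq> {1..K}" and c: "\<And>k. k \<in> {1..K} \<Longrightarrow> card {j\<in>{2..N}. e j = k} = y k"
    using e by (auto simp: words_with_counts_def)
  have "(\<Prod>j=2..N. dep_weight K p \<delta> i (e j)) =
      (\<Prod>k\<in>{1..K}. \<Prod>j\<in>{j\<in>{2..N}. e j = k}. dep_weight K p \<delta> i (e j))"
    using sub by (intro prod.group[symmetric]) auto
  also have "\<dots> = (\<Prod>k\<in>{1..K}. dep_weight K p \<delta> i k ^ y k)"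
    by (intro prod.cong refl) (simp flip: c)
  also have "\<dots> = dep_weight K p \<delta> i i ^ y i * (\<Prod>k\<in>{1..K} - {i}. dep_weight K p \<delta> i k ^ y k)"
    using i by (simp add: prod.remove)
  finally show ?thesis by (simp add: dep_weight_def)
qed

text \<open>
  The event that the counts are \<open>x\<close> is the disjoint union of the elementary events, one for each
  sequence with counts \<open>x\<close>.
\<close>

lemma prob_counts_eq_sum_words:
  assumes "dep_categorical M K p \<delta> N \<epsilon>"
  shows "measure M {\<omega> \<in> space M. \<forall>i\<in>{1..K}. cat_count N \<epsilon> i \<omega> = x i} =
    (\<Sum>e\<in>words_with_counts {1..N} {1..K} x.
       p (e 1) * (\<Prod>j=2..N. dep_weight K p \<delta> (e 1) (e j)))"
proof -
  interpret prob_space M using assms by (simp add: dep_categorical_def)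
  have meas: "\<epsilon> j \<in> measurable M (count_space {1..K})" if "j \<in> {1..N}" for j
    using assms that by (simp add: dep_categorical_def)
  let ?W = "words_with_counts {1..N} {1..K} x"
  let ?E = "\<lambda>e. {\<omega> \<in> space M. \<forall>j\<in>{1..N}. \<epsilon> j \<omega> = e j}"
  have "{\<omega> \<in> space M. \<forall>i\<in>{1..K}. cat_count N \<epsilon> i \<omega> = x i} = (\<Union>e\<in>?W. ?E e)"
  proof (intro subset_antisym subsetI)
    fix \<omega> assume \<omega>: "\<omega> \<in> {\<omega> \<in> space M. \<forall>i\<in>{1..K}. cat_count N \<epsilon> i \<omega> = x i}"
    let ?e = "restrict (\<lambda>j. \<epsilon> j \<omega>) {1..N}"
    have "?e \<in> {1..N} \<rightarrow>\<^sub>E {1..K}"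
      using measurable_space[OF meas] \<omega> by fastforce
    moreover have "{j\<in>{1..N}. ?e j = k} = {j\<in>{1..N}. \<epsilon> j \<omega> = k}" for k by auto
    ultimately have "?e \<in> ?W"
      using \<omega> by (simp add: words_with_counts_def cat_count_def)
    moreover have "\<omega> \<in> ?E ?e" using \<omega> by simp
    ultimately show "\<omega> \<in> (\<Union>e\<in>?W. ?E e)" by blast
  next
    fix \<omega> assume "\<omega> \<in> (\<Union>e\<in>?W. ?E e)"
    then obtain e where e: "e \<in> ?W" "\<omega> \<in> space M" "\<And>j. j \<in> {1..N} \<Longrightarrow> \<epsilon> j \<omega> = e j" by auto
    have "{j\<in>{1..N}. \<epsilon> j \<omega> = k} = {j\<in>{1..N}. e j = k}" for k using e(3) by auto
    then show "\<omega> \<in> {\<omega> \<in> space M. \<forall>i\<in>{1..K}. cat_count N \<epsilon> i \<omega> = x i}"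
      using e by (simp add: words_with_counts_def cat_count_def)
  qed
  moreover have "measure M (\<Union>e\<in>?W. ?E e) = (\<Sum>e\<in>?W. measure M (?E e))"
  proof (rule finite_measure_finite_Union)
    show "finite ?W" by (simp add: finite_words_with_counts)
    have "?E e \<in> sets M" for e
    proof (rule sets.sets_Collect_finite_All)
      show "{\<omega> \<in> space M. \<epsilon> j \<omega> = e j} \<in> sets M" if "j \<in> {1..N}" for j
      proof -
        have "{\<omega> \<in> space M. \<epsilon> j \<omega> = e j} = \<epsilon> j -` ({e j} \<inter> {1..K}) \<inter> space M"
          using measurable_space[OF meas[OF that]] by fastforce
        then show ?thesis using measurable_sets[OF meas[OF that], of "{e j} \<inter> {1..K}"] by simp
      qed
    qed auto
    then show "?E ` ?W \<subseteq> sets M" by blast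
    show "disjoint_family_on ?E ?W"
      unfolding disjoint_family_on_def
    proof (intro ballI impI)
      fix e f assume ef: "e \<in> ?W" "f \<in> ?W" "e \<noteq> f"
      then have "e \<in> {1..N} \<rightarrow>\<^sub>E {1..K}" "f \<in> {1..N} \<rightarrow>\<^sub>E {1..K}"
        by (simp_all add: words_with_counts_def)
      then obtain j where "j \<in> {1..N}" "e j \<noteq> f j"
        using PiE_ext ef(3) by metis
      then show "?E e \<inter> ?E f = {}" by force
    qed
  qed
  moreover have "measure M (?E e) = p (e 1) * (\<Prod>j=2..N. dep_weight K p \<delta> (e 1) (e j))"
    if "e \<in> ?W" for e
    using assms that by (simp add: dep_categorical_def words_with_counts_def)
  ultimately show ?thesis by simp
qed

theorem theorem2:
  fixes M :: "'a measure" and K N :: nat and p :: "nat \<Rightarrow> real" and \<delta> :: real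
    and \<epsilon> :: "nat \<Rightarrow> 'a \<Rightarrow> nat" and x :: "nat \<Rightarrow> nat"
  assumes "K \<ge> 2"
    and "\<And>i. i \<in> {1..K} \<Longrightarrow> 0 < p i \<and> p i < 1"
    and "(\<Sum>i=1..K. p i) = 1"
    and "0 \<le> \<delta>" and "\<delta> \<le> 1"
    and "N \<ge> 1"
    and "dep_categorical M K p \<delta> N \<epsilon>"
    and "(\<Sum>i=1..K. x i) = N"
  shows "measure M {\<omega> \<in> space M. \<forall>i\<in>{1..K}. cat_count N \<epsilon> i \<omega> = x i} =
    (\<Sum>i=1..K. if x i = 0 then 0 else
       p i * (fact (N - 1) / (fact (x i - 1) * (\<Prod>j\<in>{1..K} - {i}. fact (x j))))
         * p_plus K p \<delta> i ^ (x i - 1)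
         * (\<Prod>j\<in>{1..K} - {i}. p_minus p \<delta> j ^ x j))"
proof -
  let ?W = "words_with_counts {1..N} {1..K} x"
  let ?g = "\<lambda>e. p (e 1) * (\<Prod>j=2..N. dep_weight K p \<delta> (e 1) (e j))"
  have N: "{1..N} = insert 1 {2..N}" using assms(6) by auto
  have fibre: "(\<Sum>e\<in>{e\<in>?W. e 1 = i}. ?g e) = (if x i = 0 then 0 else
       p i * (fact (N - 1) / (fact (x i - 1) * (\<Prod>j\<in>{1..K} - {i}. fact (x j))))
         * p_plus K p \<delta> i ^ (x i - 1)
         * (\<Prod>j\<in>{1..K} - {i}. p_minus p \<delta> j ^ x j))" if i: "i \<in> {1..K}" for i
  proof (cases "x i = 0")
    case True
    have "{e\<in>?W. e 1 = i} = {}"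
      using words_with_counts_value_pos[of "{1..N}" 1 _ "{1..K}" x] True assms(6) by force
    then show ?thesis using True by (simp only: sum.empty simp_thms if_True)
  next
    case False
    let ?y = "x(i := x i - 1)"
    let ?c = "p_plus K p \<delta> i ^ (x i - 1) * (\<Prod>j\<in>{1..K} - {i}. p_minus p \<delta> j ^ x j)"
    let ?F = "fact (x i - 1) * (\<Prod>j\<in>{1..K} - {i}. fact (x j)) :: real"
    have bij: "bij_betw (\<lambda>e. e(1 := undefined)) {e\<in>?W. e 1 = i} (words_with_counts {2..N} {1..K} ?y)"
      unfolding N using i False by (intro bij_betw_delete_position) auto
    \<comment> \<open>Passing to the shortened word turns the exponent of \<open>p\<^sub>i\<^sup>+\<close> into \<open>x i - 1\<close>.\<close>
    have "?g e = p i * ?c" if e: "e \<in> {e\<in>?W. e 1 = i}" for e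
    proof -
      have "(\<Prod>j=2..N. dep_weight K p \<delta> i (e j)) =
          (\<Prod>j=2..N. dep_weight K p \<delta> i ((e(1 := undefined)) j))"
        by (intro prod.cong) auto
      also have "\<dots> = p_plus K p \<delta> i ^ ?y i * (\<Prod>k\<in>{1..K} - {i}. p_minus p \<delta> k ^ ?y k)"
        by (rule prod_dep_weight[OF bspec[OF bij_betwE[OF bij] e] i])
      also have "\<dots> = ?c"
        by (intro arg_cong2[where f = "(*)"] prod.cong) auto
      finally show ?thesis using e by simp
    qed
    then have "(\<Sum>e\<in>{e\<in>?W. e 1 = i}. ?g e) = (\<Sum>e\<in>{e\<in>?W. e 1 = i}. p i * ?c)"
      by (intro sum.cong refl)
    also have "\<dots> = card {e\<in>?W. e 1 = i} * (p i * ?c)"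
      by (rule sum_constant)
    also have "card {e\<in>?W. e 1 = i} = card (words_with_counts {2..N} {1..K} ?y)"
      by (rule bij_betw_same_card[OF bij])
    also have "real \<dots> = fact (N - 1) / ?F"
    proof -
      have "sum x {1..K} = x i + sum x ({1..K} - {i})"
        "sum ?y {1..K} = (x i - 1) + sum x ({1..K} - {i})"
        using i by (simp_all add: sum.remove)
      then have "sum ?y {1..K} = card {2..N}" using assms(8) False by simp
      then have "card (words_with_counts {2..N} {1..K} ?y) * (\<Prod>k\<in>{1..K}. fact (?y k)) = fact (N - 1)"
        using card_words_with_counts[of "{2..N}" "{1..K}" ?y] by simp
      then have "real (card (words_with_counts {2..N} {1..K} ?y)) * (\<Prod>k\<in>{1..K}. fact (?y k)) = fact (N - 1)"
        by (metis (mono_tags, lifting) of_nat_mult of_nat_prod of_nat_fact prod.cong)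
      moreover have "(\<Prod>k\<in>{1..K}. fact (?y k)) = ?F"
      proof -
        have "(\<Prod>k\<in>{1..K} - {i}. fact (?y k)) = (\<Prod>k\<in>{1..K} - {i}. fact (x k) :: real)"
          by (intro prod.cong) auto
        then show ?thesis
          by (simp only: prod.remove[OF finite_atLeastAtMost i] fun_upd_same)
      qed
      moreover have "?F \<noteq> 0" by simp
      ultimately show ?thesis by (metis eq_divide_imp)
    qed
    finally show ?thesis using False by (simp add: mult_ac)
  qed
  have "(\<lambda>e. e 1) ` ?W \<subseteq> {1..K}"
    using assms(6) by (auto simp: words_with_counts_def PiE_iff)
  then have "(\<Sum>e\<in>?W. ?g e) = (\<Sum>i\<in>{1..K}. \<Sum>e\<in>{e\<in>?W. e 1 = i}. ?g e)"
    by (intro sum.group[symmetric] finite_words_with_counts) auto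
  then show ?thesis
    unfolding prob_counts_eq_sum_words[OF assms(7)] by (simp only: fibre cong: sum.cong)
qed

end
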